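(* For $c,d\in\mathbb C^4$ the following hold: (i) if $|c_i|=|d_i|$ for each $i=1,2,3,4$ and $|\phi_c|=|\phi_d|$, then $\|c\|_{\mathsf X}'=\|d\|_{\mathsf X}'$; (ii) $\|(c_1,c_2,c_3,c_4)\|_{\mathsf X}'=\|(\bar c_1,\bar c_2,\bar c_3,\bar c_4)\|_{\mathsf X}'$; (iii) if one of the entries of $c$ is zero, then $\|c\|_{\mathsf X}'=\|(|c_1|,|c_2|,|c_3|,|c_4|)\|_{\mathsf X}'$.
   Context: On $\mathbb C^4$ define the norm $\|z\|_{\mathsf X}=\max_{\sigma\in\mathbb R}\left(|z_1e^{\mathrm i\sigma}+\bar z_4|+|z_2e^{\mathrm i\sigma}+\bar z_3|\right)$ and its dual norm $\|c\|_{\mathsf X}'=\max\{|\langle c,z\rangle|:\|z\|_{\mathsf X}=1\}$, where $\langle c,z\rangle=\sum_{i=1}^4c_iz_i$ (bilinear). Writing $c_j=|c_j|e^{\mathrm i\theta_j}$, the phase difference of $c$ is $\phi_c=(\theta_1+\theta_4)-(\theta_2+\theta_3)$ mod $2\pi$ (if some $c_j=0$, any $\theta_j$ may be chosen); $|\phi_c|$ is the absolute value of the representative in $(-\pi,\pi]$, so $|\phi_c|=|\phi_d|$ means $\phi_c\equiv\pm\phi_d$ mod $2\pi$. *)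

theory Defs
  imports "HOL-Analysis.Analysis" "HOL-Library.Real_Mod"
begin

definition X_fun :: "complex^4 \<Rightarrow> real \<Rightarrow> real" where
  "X_fun z \<sigma> = cmod (z$1 * cis \<sigma> + cnj (z$4)) + cmod (z$2 * cis \<sigma> + cnj (z$3))"

text \<open>Both suprema below are attained, see \<open>norm_X_is_max\<close> and \<open>dual_norm_X_is_max\<close>.\<close>

definition norm_X :: "complex^4 \<Rightarrow> real" where
  "norm_X z = (SUP \<sigma>. X_fun z \<sigma>)"

text \<open>The pairing is bilinear, so it is not the Hermitian inner product.\<close>

definition pairing :: "complex^4 \<Rightarrow> complex^4 \<Rightarrow> complex" where
  "pairing c z = (\<Sum>i\<in>UNIV. c$i * z$i)"

definition dual_norm_X :: "complex^4 \<Rightarrow> real" where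
  "dual_norm_X c = (SUP z\<in>{z. norm_X z = 1}. cmod (pairing c z))"

text \<open>
  \<open>is_phase_difference c \<phi>\<close>: \<open>\<phi>\<close> is the representative in \<open>(-\<pi>,\<pi>]\<close> of the phase difference
  of \<open>c\<close> for some choice of arguments \<open>\<theta>\<close> of its entries. If all entries are nonzero there is
  exactly one such \<open>\<phi>\<close>; if some entry is zero, its argument is arbitrary and every \<open>\<phi>\<close> in
  \<open>(-\<pi>,\<pi>]\<close> qualifies.
\<close>

definition is_phase_difference :: "complex^4 \<Rightarrow> real \<Rightarrow> bool" where
  "is_phase_difference c \<phi> \<longleftrightarrow> \<phi> \<in> {-pi<..pi} \<and>
     (\<exists>\<theta> :: 4 \<Rightarrow> real. (\<forall>j. c$j = rcis (cmod (c$j)) (\<theta> j)) \<and>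
        [\<phi> = (\<theta> 1 + \<theta> 4) - (\<theta> 2 + \<theta> 3)] (rmod 2 * pi))"

lemma X_fun_attains_max: "\<exists>\<sigma>. \<forall>\<tau>. X_fun z \<tau> \<le> X_fun z \<sigma>"
proof -
  have per: "X_fun z (2 * pi * frac (\<tau> / (2*pi))) = X_fun z \<tau>" for \<tau>
  proof -
    have "cis (2 * pi * frac (\<tau> / (2*pi))) = cis (\<tau> - 2 * pi * of_int \<lfloor>\<tau> / (2*pi)\<rfloor>)"
      by (simp add: frac_def right_diff_distrib)
    also have "\<dots> = cis \<tau>"
      by (metis cis_divide cis_multiple_2pi div_by_1 Ints_of_int)
    finally show ?thesis by (simp add: X_fun_def)
  qed
  have "continuous_on {0..2*pi} (X_fun z)"
    unfolding X_fun_def[abs_def] by (intro continuous_intros)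
  then obtain \<sigma> where s: "\<forall>\<tau>\<in>{0..2*pi}. X_fun z \<tau> \<le> X_fun z \<sigma>"
    using continuous_attains_sup[of "{0..2*pi}" "X_fun z"] by auto
  have "2 * pi * frac (\<tau> / (2*pi)) \<in> {0..2*pi}" for \<tau>
    using frac_lt_1[of "\<tau> / (2*pi)"] by (simp add: mult_le_cancel_left1)
  then have "X_fun z \<tau> \<le> X_fun z \<sigma>" for \<tau> using s per by metis
  then show ?thesis by blast
qed

lemma norm_X_is_max: "\<exists>\<sigma>. norm_X z = X_fun z \<sigma> \<and> (\<forall>\<tau>. X_fun z \<tau> \<le> norm_X z)"
proof -
  obtain \<sigma> where s: "\<forall>\<tau>. X_fun z \<tau> \<le> X_fun z \<sigma>" using X_fun_attains_max by blast
  have "norm_X z = X_fun z \<sigma>"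
    unfolding norm_X_def by (rule cSup_eq_maximum) (use s in auto)
  then show ?thesis using s by auto
qed

lemma X_fun_triangle: "X_fun (z + w) \<sigma> \<le> X_fun z \<sigma> + X_fun w \<sigma>"
proof -
  have "cmod ((z+w)$1 * cis \<sigma> + cnj ((z+w)$4))
      \<le> cmod (z$1 * cis \<sigma> + cnj (z$4)) + cmod (w$1 * cis \<sigma> + cnj (w$4))"
    by (rule order_trans[OF _ norm_triangle_ineq]) (simp add: algebra_simps)
  moreover have "cmod ((z+w)$2 * cis \<sigma> + cnj ((z+w)$3))
      \<le> cmod (z$2 * cis \<sigma> + cnj (z$3)) + cmod (w$2 * cis \<sigma> + cnj (w$3))"
    by (rule order_trans[OF _ norm_triangle_ineq]) (simp add: algebra_simps)
  ultimately show ?thesis unfolding X_fun_def by linarith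
qed

lemma norm_X_triangle: "norm_X (z + w) \<le> norm_X z + norm_X w"
  using norm_X_is_max[of "z+w"] norm_X_is_max[of z] norm_X_is_max[of w] X_fun_triangle
  by (smt (verit))

lemma norm_X_le: "norm_X z \<le> 4 * norm z"
proof -
  obtain \<sigma> where "norm_X z = X_fun z \<sigma>" using norm_X_is_max by blast
  moreover have "cmod (z$1 * cis \<sigma> + cnj (z$4)) \<le> cmod (z$1) + cmod (z$4)"
    by (rule order_trans[OF norm_triangle_ineq]) (simp add: norm_mult)
  moreover have "cmod (z$2 * cis \<sigma> + cnj (z$3)) \<le> cmod (z$2) + cmod (z$3)"
    by (rule order_trans[OF norm_triangle_ineq]) (simp add: norm_mult)
  ultimately show ?thesis
    using Finite_Cartesian_Product.norm_nth_le[of z 1] Finite_Cartesian_Product.norm_nth_le[of z 2]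
      Finite_Cartesian_Product.norm_nth_le[of z 3] Finite_Cartesian_Product.norm_nth_le[of z 4]
    unfolding X_fun_def by linarith
qed

lemma cmod_le_pm:
  assumes "cmod (a + b) \<le> N" "cmod (- a + b) \<le> N"
  shows "cmod a \<le> N" "cmod b \<le> N"
proof -
  have "cmod ((a + b) - (- a + b)) \<le> N + N" "cmod ((a + b) + (- a + b)) \<le> N + N"
    using assms norm_triangle_ineq4[of "a+b" "-a+b"] norm_triangle_ineq[of "a+b" "-a+b"]
    by linarith+
  moreover have "(a + b) - (- a + b) = 2 * a" "(a + b) + (- a + b) = 2 * b" by simp_all
  ultimately have "cmod (2 * a) \<le> N + N" "cmod (2 * b) \<le> N + N" by metis+
  then show "cmod a \<le> N" "cmod b \<le> N" by (simp_all add: norm_mult)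
qed

lemma cmod_nth_le_norm_X: "cmod (z$i) \<le> norm_X z"
proof -
  have m: "X_fun z 0 \<le> norm_X z" "X_fun z pi \<le> norm_X z"
    using norm_X_is_max[of z] by auto
  have n: "cmod (z$1 + cnj (z$4)) \<ge> 0" "cmod (z$2 + cnj (z$3)) \<ge> 0"
    "cmod (- z$1 + cnj (z$4)) \<ge> 0" "cmod (- z$2 + cnj (z$3)) \<ge> 0" by simp_all
  have s: "cmod (z$1 + cnj (z$4)) + cmod (z$2 + cnj (z$3)) \<le> norm_X z"
     "cmod (- z$1 + cnj (z$4)) + cmod (- z$2 + cnj (z$3)) \<le> norm_X z"
    using m by (simp_all add: X_fun_def)
  have "cmod (z$1) \<le> norm_X z" "cmod (cnj (z$4)) \<le> norm_X z"
    using cmod_le_pm[of "z$1" "cnj (z$4)" "norm_X z"] s n by linarith+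
  moreover have "cmod (z$2) \<le> norm_X z" "cmod (cnj (z$3)) \<le> norm_X z"
    using cmod_le_pm[of "z$2" "cnj (z$3)" "norm_X z"] s n by linarith+
  ultimately show ?thesis using exhaust_4[of i] by auto
qed

lemma continuous_norm_X: "continuous_on UNIV norm_X"
proof -
  have "\<bar>norm_X z - norm_X w\<bar> \<le> 4 * norm (z - w)" for z w
    using norm_X_triangle[of "z - w" w] norm_X_triangle[of "w - z" z]
      norm_X_le[of "z - w"] norm_X_le[of "w - z"] norm_minus_commute[of z w]
    by simp
  then have "4-lipschitz_on UNIV norm_X"
    by (intro lipschitz_onI) (auto simp: dist_norm)
  then show ?thesis by (rule lipschitz_on_continuous_on)
qed

lemma norm_X_sphere_nonempty: "\<exists>z. norm_X z = 1"
proof -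
  have "X_fun (axis 1 1) \<sigma> = 1" for \<sigma> by (simp add: X_fun_def axis_def)
  then show ?thesis using norm_X_is_max by metis
qed

lemma dual_norm_X_is_max:
  "\<exists>z. norm_X z = 1 \<and> dual_norm_X c = cmod (pairing c z) \<and>
       (\<forall>w. norm_X w = 1 \<longrightarrow> cmod (pairing c w) \<le> dual_norm_X c)"
proof -
  let ?S = "{z. norm_X z = 1}"
  have "closed ?S"
    by (rule closed_Collect_eq) (auto intro: continuous_norm_X continuous_intros)
  moreover have "norm z \<le> 4" if "z \<in> ?S" for z
  proof -
    have "norm z \<le> (\<Sum>i\<in>UNIV. cmod (z$i))" unfolding norm_vec_def by (rule L2_set_le_sum) simp
    also have "\<dots> \<le> (\<Sum>i\<in>(UNIV::4 set). 1)"
      using that cmod_nth_le_norm_X by (intro sum_mono) (metis mem_Collect_eq)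
    finally show ?thesis by simp
  qed
  ultimately have "compact ?S" by (auto simp: compact_eq_bounded_closed bounded_iff)
  moreover have "continuous_on ?S (\<lambda>z. cmod (pairing c z))"
    unfolding pairing_def by (intro continuous_intros)
  moreover have "?S \<noteq> {}" using norm_X_sphere_nonempty by auto
  ultimately obtain z where z: "z \<in> ?S" "\<forall>w\<in>?S. cmod (pairing c w) \<le> cmod (pairing c z)"
    using continuous_attains_sup by blast
  have "dual_norm_X c = cmod (pairing c z)"
    unfolding dual_norm_X_def by (rule cSup_eq_maximum) (use z in auto)
  then show ?thesis using z by auto
qed

end

theory Submission
  imports Defs
begin

text \<open>
  The norm \<open>norm_X\<close> is invariant under complex conjugation, which reflects \<open>\<sigma>\<close>, and under
  multiplication of the entries by unimodular \<open>u\<^sub>j\<close> with \<open>u\<^sub>1 u\<^sub>4 = u\<^sub>2 u\<^sub>3\<close>, which translates \<open>\<sigma>\<close> by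
  the argument of \<open>u\<^sub>1 u\<^sub>4\<close>. Both symmetries pass to the dual norm. Rotations relate any two vectors
  with the same moduli and the same phase difference, and conjugation flips the sign of the phase
  difference. If an entry vanishes, its argument can be chosen to make the phase difference zero,
  which is the phase difference of the vector of moduli.
\<close>

lemma norm_X_cnj: "norm_X (\<chi> i. cnj (z$i)) = norm_X z"
proof -
  have "X_fun (\<chi> i. cnj (z$i)) \<sigma> = X_fun z (- \<sigma>)" for \<sigma>
  proof -
    \<comment> \<open>A modulus does not change when its whole argument is conjugated; this moves
      the conjugation from \<open>a\<close> to \<open>b\<close> and reflects \<sigma>.\<close>
    have "cmod (cnj a * cis \<sigma> + b) = cmod (a * cis (-\<sigma>) + cnj b)" for a b
      by (subst complex_mod_cnj[symmetric]) (simp add: cis_cnj)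
    then show ?thesis by (simp add: X_fun_def)
  qed
  then have "range (X_fun (\<chi> i. cnj (z$i))) = X_fun z ` range uminus"
    unfolding image_image by simp
  then show ?thesis by (simp add: norm_X_def surj_uminus)
qed

lemma norm_X_rotate:
  assumes "\<And>i. cmod (u i) = 1" and "u 1 * u 4 = u 2 * u 3"
  shows "norm_X (\<chi> i. u i * z$i) = norm_X z"
proof -
  define \<tau> where "\<tau> = Arg (u 1 * u 4)"
  have \<tau>: "u 1 * u 4 = cis \<tau>"
    using rcis_cmod_Arg[of "u 1 * u 4"] assms(1) by (simp add: norm_mult rcis_def \<tau>_def)
  have rot: "cmod (v * a * cis \<sigma> + cnj (w * b)) = cmod (a * cis (\<tau> + \<sigma>) + cnj b)"
    if "v * w = cis \<tau>" "cmod w = 1" for v w a b \<sigma>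
  proof -
    \<comment> \<open>Multiplying inside the modulus by the unimodular \<open>w\<close> cancels the
      factor of the conjugated entry and collects \<open>v * w\<close>, which is the same
      \<open>cis \<tau>\<close> for both pairs of entries.\<close>
    have "w * cnj w = 1" using that(2) by (simp add: complex_norm_square[symmetric])
    then have "w * (v * a * cis \<sigma> + cnj (w * b)) = (v * w) * a * cis \<sigma> + cnj b"
      by (simp add: algebra_simps)
    also have "\<dots> = a * cis (\<tau> + \<sigma>) + cnj b"
      by (simp add: that(1) cis_mult[symmetric])
    finally have "cmod (w * (v * a * cis \<sigma> + cnj (w * b))) = cmod (a * cis (\<tau> + \<sigma>) + cnj b)"
      by simp
    then show ?thesis by (simp only: norm_mult that(2) mult_1)
  qed
  have "X_fun (\<chi> i. u i * z$i) \<sigma> = X_fun z (\<tau> + \<sigma>)" for \<sigma>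
    using rot[of "u 1" "u 4"] rot[of "u 2" "u 3"] \<tau> assms by (simp add: X_fun_def)
  then have "range (X_fun (\<chi> i. u i * z$i)) = X_fun z ` range ((+) \<tau>)"
    unfolding image_image by simp
  then show ?thesis by (simp add: norm_X_def)
qed

text \<open>The map \<open>f\<close> carries a maximiser for \<open>c\<close> to a unit vector that
  competes in the maximum for \<open>d\<close>.\<close>

lemma dual_norm_X_mono:
  assumes "\<And>z. norm_X (f z) = norm_X z" "\<And>z. cmod (pairing c z) = cmod (pairing d (f z))"
  shows "dual_norm_X c \<le> dual_norm_X d"
  using assms dual_norm_X_is_max[of c] dual_norm_X_is_max[of d] by metis

text \<open>Conjugation is an involution, so one inequality, applied to \<open>c\<close> and to its
  conjugate, gives equality.\<close>

lemma dual_norm_X_cnj: "dual_norm_X (\<chi> i. cnj (c$i)) = dual_norm_X c"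
proof -
  have "cmod (pairing (\<chi> i. cnj (c$i)) (\<chi> i. cnj (z$i))) = cmod (pairing c z)" for c z
    using complex_mod_cnj[of "pairing c z"] by (simp add: pairing_def)
  then have "dual_norm_X c \<le> dual_norm_X (\<chi> i. cnj (c$i))" for c
    by (intro dual_norm_X_mono[OF norm_X_cnj]) simp
  from this[of c] this[of "\<chi> i. cnj (c$i)"] show ?thesis by simp
qed

lemma dual_norm_X_rotate:
  assumes "\<And>i. cmod (u i) = 1" and "u 1 * u 4 = u 2 * u 3"
  shows "dual_norm_X (\<chi> i. u i * c$i) = dual_norm_X c"
proof -
  \<comment> \<open>By bilinearity the factors move from \<open>e\<close> to the test vector. The
    reverse inequality comes from rotating back by the inverse factors
    \<open>cnj (u i)\<close>.\<close>
  have le: "dual_norm_X (\<chi> i. v i * e$i) \<le> dual_norm_X e"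
    if "\<And>i. cmod (v i) = 1" "v 1 * v 4 = v 2 * v 3" for v e
    by (rule dual_norm_X_mono[OF norm_X_rotate[OF that]]) (simp add: pairing_def mult_ac)
  have "cnj (u i) * (u i * c$i) = c$i" for i
  proof -
    have "cnj (u i) * u i = 1"
      using assms(1)[of i] by (simp add: complex_norm_square[symmetric] mult.commute)
    then show ?thesis by (simp flip: mult.assoc)
  qed
  then have "(\<chi> i. cnj (u i) * (u i * c$i)) = c" by (simp only: vec_lambda_eta)
  then have "dual_norm_X c \<le> dual_norm_X (\<chi> i. u i * c$i)"
    using le[of "\<lambda>i. cnj (u i)" "\<chi> i. u i * c$i"] assms
    by (simp flip: complex_cnj_mult)
  with le[OF assms, of c] show ?thesis by simp
qed

lemma cis_cong_rmod: "[x = y] (rmod 2 * pi) \<Longrightarrow> cis x = cis y"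
  by (simp add: complex_eq_iff sin_rcong cos_rcong)

lemma dual_norm_X_eq_of_phase_difference:
  assumes "\<And>i. cmod (c$i) = cmod (d$i)"
    and "is_phase_difference c \<phi>" and "is_phase_difference d \<phi>"
  shows "dual_norm_X c = dual_norm_X d"
proof -
  obtain \<theta> where \<theta>: "\<And>j. c$j = rcis (cmod (c$j)) (\<theta> j)"
      "[\<phi> = (\<theta> 1 + \<theta> 4) - (\<theta> 2 + \<theta> 3)] (rmod 2 * pi)"
    using assms(2) unfolding is_phase_difference_def by auto
  obtain \<eta> where \<eta>: "\<And>j. d$j = rcis (cmod (d$j)) (\<eta> j)"
      "[\<phi> = (\<eta> 1 + \<eta> 4) - (\<eta> 2 + \<eta> 3)] (rmod 2 * pi)"
    using assms(3) unfolding is_phase_difference_def by auto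
  \<comment> \<open>These factors turn the chosen arguments of \<open>c\<close> into those of
    \<open>d\<close>; equal phase differences give exactly the relation that rotation invariance
    requires.\<close>
  let ?u = "\<lambda>j. cis (\<eta> j - \<theta> j)"
  have "cis ((\<theta> 1 + \<theta> 4) - (\<theta> 2 + \<theta> 3)) = cis ((\<eta> 1 + \<eta> 4) - (\<eta> 2 + \<eta> 3))"
    using cis_cong_rmod[OF \<theta>(2)] cis_cong_rmod[OF \<eta>(2)] by simp
  then have "?u 1 * ?u 4 = ?u 2 * ?u 3"
    by (simp add: cis_mult[symmetric] cis_divide[symmetric] field_simps)
  then have "dual_norm_X (\<chi> i. ?u i * c$i) = dual_norm_X c"
    by (intro dual_norm_X_rotate) simp_all
  moreover have "(\<chi> i. ?u i * c$i) = d"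
    unfolding vec_eq_iff
  proof
    fix i
    have "?u i * c$i = rcis (cmod (d$i)) (\<eta> i)"
      by (subst \<theta>(1)) (simp add: assms(1) rcis_def cis_mult)
    then show "(\<chi> i. ?u i * c$i)$i = d$i" using \<eta>(1) by simp
  qed
  ultimately show ?thesis by simp
qed

text \<open>Conjugation negates every argument. The value \<open>pi\<close> is excluded because
  \<open>- pi\<close> lies outside the half-open interval of representatives.\<close>

lemma is_phase_difference_cnj:
  assumes "is_phase_difference c \<phi>" "\<phi> \<noteq> pi"
  shows "is_phase_difference (\<chi> i. cnj (c$i)) (- \<phi>)"
proof -
  obtain \<theta> where \<theta>: "\<And>j. c$j = rcis (cmod (c$j)) (\<theta> j)"
      "[\<phi> = (\<theta> 1 + \<theta> 4) - (\<theta> 2 + \<theta> 3)] (rmod 2 * pi)"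
    using assms(1) unfolding is_phase_difference_def by auto
  have "cnj (c$j) = rcis (cmod (c$j)) (- \<theta> j)" for j
    by (subst \<theta>(1)) (simp add: rcis_def cis_cnj)
  moreover have "[- \<phi> = (- \<theta> 1 + - \<theta> 4) - (- \<theta> 2 + - \<theta> 3)] (rmod 2 * pi)"
    using rcong_uminus[OF \<theta>(2)] by (simp add: algebra_simps)
  ultimately show ?thesis
    using assms unfolding is_phase_difference_def
    by (auto intro!: exI[of _ "\<lambda>j. - \<theta> j"])
qed

lemma is_phase_difference_zero_entry:
  assumes "c$k = 0"
  shows "is_phase_difference c 0"
proof -
  \<comment> \<open>\<open>s j\<close> is the sign with which the argument of entry \<open>j\<close>
    enters the phase difference, and \<open>r\<close> is the phase difference of the principal
    arguments. Lowering the free argument at \<open>k\<close> by \<open>s k * r\<close> removes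
    \<open>s k * s k * r = r\<close>.\<close>
  define s where "s = (\<lambda>j::4. if j = 1 \<or> j = 4 then 1 else - 1 :: real)"
  define r where "r = s 1 * Arg (c$1) + s 2 * Arg (c$2) + s 3 * Arg (c$3) + s 4 * Arg (c$4)"
  define \<theta> where "\<theta> = (\<lambda>j. Arg (c$j) - (if j = k then s k * r else 0))"
  have "c$j = rcis (cmod (c$j)) (\<theta> j)" for j
    using assms by (simp add: \<theta>_def rcis_cmod_Arg)
  moreover have "(\<theta> 1 + \<theta> 4) - (\<theta> 2 + \<theta> 3) = 0"
    using exhaust_4[of k] by (auto simp: \<theta>_def s_def r_def)
  ultimately show ?thesis
    unfolding is_phase_difference_def by (auto intro!: exI[of _ \<theta>])
qed

lemma is_phase_difference_moduli:
  "is_phase_difference (\<chi> i. complex_of_real (cmod (c$i))) 0"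
  unfolding is_phase_difference_def by (auto intro!: exI[of _ "\<lambda>_. 0"] simp: rcis_def)

theorem proposition3p4:
  fixes c d :: "complex^4"
  shows "((\<forall>i. cmod (c$i) = cmod (d$i)) \<and>
          (\<exists>\<phi> \<psi>. is_phase_difference c \<phi> \<and> is_phase_difference d \<psi> \<and> \<bar>\<phi>\<bar> = \<bar>\<psi>\<bar>)
            \<longrightarrow> dual_norm_X c = dual_norm_X d)
       \<and> dual_norm_X c = dual_norm_X (\<chi> i. cnj (c$i))
       \<and> ((\<exists>i. c$i = 0) \<longrightarrow> dual_norm_X c = dual_norm_X (\<chi> i. complex_of_real (cmod (c$i))))"
proof (intro conjI impI)
  assume "(\<forall>i. cmod (c$i) = cmod (d$i)) \<and>
    (\<exists>\<phi> \<psi>. is_phase_difference c \<phi> \<and> is_phase_difference d \<psi> \<and> \<bar>\<phi>\<bar> = \<bar>\<psi>\<bar>)"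
  then obtain \<phi> \<psi> where mods: "\<And>i. cmod (c$i) = cmod (d$i)"
    and pd: "is_phase_difference c \<phi>" "is_phase_difference d \<psi>" and "\<bar>\<phi>\<bar> = \<bar>\<psi>\<bar>"
    by auto
  show "dual_norm_X c = dual_norm_X d"
  proof (cases "\<phi> = \<psi>")
    case True
    then show ?thesis using dual_norm_X_eq_of_phase_difference[OF mods] pd by simp
  next
    case False
    with \<open>\<bar>\<phi>\<bar> = \<bar>\<psi>\<bar>\<close> have "\<psi> = - \<phi>" by linarith
    \<comment> \<open>Otherwise \<psi> would be \<open>- pi\<close>, which is not an admissible
      representative.\<close>
    moreover have "\<phi> \<noteq> pi"
      using pd(2) \<open>\<psi> = - \<phi>\<close> by (auto simp: is_phase_difference_def)
    ultimately show ?thesis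
      using dual_norm_X_eq_of_phase_difference[of "\<chi> i. cnj (c$i)" d \<psi>]
        is_phase_difference_cnj[OF pd(1)] pd(2) mods
      by (simp add: dual_norm_X_cnj)
  qed
next
  show "dual_norm_X c = dual_norm_X (\<chi> i. cnj (c$i))"
    by (simp add: dual_norm_X_cnj)
next
  assume "\<exists>i. c$i = 0"
  then show "dual_norm_X c = dual_norm_X (\<chi> i. complex_of_real (cmod (c$i)))"
    by (auto intro!: dual_norm_X_eq_of_phase_difference[of _ _ 0]
        intro: is_phase_difference_zero_entry is_phase_difference_moduli)
qed

end
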